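(* Let $R_1,\dots,R_k$ be commutative rings with identity. If $\Gamma(R_i)$ is non-chordal for some $i$, then $\Gamma(R_1\times\cdots\times R_k)$ is non-chordal.
   Context: For a commutative ring $R$ with identity, the zero-divisor graph $\Gamma(R)$ is the simple undirected graph whose vertices are the nonzero zero-divisors of $R$, two distinct vertices $u,v$ being adjacent iff $uv=0$. A graph is chordal if every cycle of length greater than $3$ has a chord. *)

theory Defs
  imports "HOL-Algebra.Chinese_Remainder" "Graph_Theory.Pair_Digraph"
begin

definition zero_divisor :: "('a, 'm) ring_scheme \<Rightarrow> 'a \<Rightarrow> bool" where
  "zero_divisor R a \<longleftrightarrow>
     a \<in> carrier R \<and> (\<exists>b \<in> carrier R. b \<noteq> \<zero>\<^bsub>R\<^esub> \<and> a \<otimes>\<^bsub>R\<^esub> b = \<zero>\<^bsub>R\<^esub>)"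

(* As usual in Graph_Theory, an undirected graph is a symmetric digraph: each undirected edge
   {u, v} is represented by the two arcs (u, v) and (v, u).  The graph may be infinite. *)

definition zero_divisor_graph :: "('a, 'm) ring_scheme \<Rightarrow> 'a pair_pre_digraph" where
  "zero_divisor_graph R =
     (let V = {a. zero_divisor R a \<and> a \<noteq> \<zero>\<^bsub>R\<^esub>}
      in \<lparr> pverts = V,
           parcs = {(u, v). u \<in> V \<and> v \<in> V \<and> u \<noteq> v \<and> u \<otimes>\<^bsub>R\<^esub> v = \<zero>\<^bsub>R\<^esub>} \<rparr>)"

lemma (in cring) zero_divisor_graph_simple_undirected:
  "pair_bidirected_digraph (zero_divisor_graph R)"
proof
  show "symmetric (with_proj (zero_divisor_graph R))"
    unfolding symmetric_def with_proj_simps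
  proof (rule symI)
    fix u v assume "(u, v) \<in> parcs (zero_divisor_graph R)"
    moreover from this have "u \<in> carrier R" "v \<in> carrier R"
      by (auto simp: zero_divisor_graph_def Let_def zero_divisor_def)
    ultimately show "(v, u) \<in> parcs (zero_divisor_graph R)"
      using m_comm[of u v] by (auto simp: zero_divisor_graph_def Let_def)
  qed
qed (auto simp: zero_divisor_graph_def Let_def)

(* A cycle is given by its list p of arcs; every vertex of the cycle is the tail of exactly one
   of them. *)

definition is_chord :: "'a pair_pre_digraph \<Rightarrow> ('a \<times> 'a) awalk \<Rightarrow> 'a \<Rightarrow> 'a \<Rightarrow> bool" where
  "is_chord G p u v \<longleftrightarrow>
     (u, v) \<in> parcs G \<and> u \<in> fst ` set p \<and> v \<in> fst ` set p \<and>
     (u, v) \<notin> set p \<and> (v, u) \<notin> set p"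

(* pre_digraph.cycle also admits u, v, u in a symmetric digraph, but the length bound excludes
   this degenerate case. *)

definition chordal :: "'a pair_pre_digraph \<Rightarrow> bool" where
  "chordal G \<longleftrightarrow>
     (\<forall>p. pre_digraph.cycle (with_proj G) p \<and> length p > 3 \<longrightarrow> (\<exists>u v. is_chord G p u v))"

end

theory Submission
  imports Defs
begin

text \<open>
  Placing an element in the \<open>i\<close>-th coordinate and zero in all the others is an injective
  map that preserves products and zero (though not the identity, so it is no ring homomorphism).
  Such a map embeds one zero-divisor graph in the other as an induced subgraph, and induced
  subgraphs of chordal graphs are chordal.
\<close>

lemma pcas_map:
  "pcas u p v \<Longrightarrow> pcas (f u) (map (map_prod f f) p) (f v)"
  by (induction u p v rule: pcas.induct) auto

lemma pawalk_verts_map: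
  "pawalk_verts (f u) (map (map_prod f f) p) = map f (pawalk_verts u p)"
  by (induction p arbitrary: u) auto

text \<open>A cycle of \<open>G\<close> is pushed forward along \<open>f\<close>, and a chord found
  in \<open>H\<close> is pulled back. Injectivity keeps the pushed walk a cycle. The equivalence in
  \<open>arcs\<close> is used both ways: preservation moves the cycle to \<open>H\<close>,
  reflection brings the chord back to \<open>G\<close>.\<close>

lemma chordal_induced_subgraph:
  assumes G: "pair_wf_digraph G"
    and inj: "inj_on f (pverts G)"
    and verts: "f ` pverts G \<subseteq> pverts H"
    and arcs: "\<And>u v. \<lbrakk>u \<in> pverts G; v \<in> pverts G\<rbrakk> \<Longrightarrow> (f u, f v) \<in> parcs H \<longleftrightarrow> (u, v) \<in> parcs G"
    and chordal: "chordal H"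
  shows "chordal G"
  unfolding chordal_def
proof (intro allI impI, elim conjE)
  interpret pair_wf_digraph G by (fact G)
  fix p assume cyc: "pre_digraph.cycle (with_proj G) p" and len: "length p > 3"
  from cyc obtain u where walk: "awalk u p u" and dist: "distinct (tl (pawalk_verts u p))"
    and "p \<noteq> []"
    unfolding cycle_def by auto
  have u: "u \<in> pverts G" and p: "set p \<subseteq> parcs G" and cas: "pcas u p u"
    using walk unfolding awalk_def by auto
  have walk_verts: "set (pawalk_verts u p) \<subseteq> pverts G"
    using walk by blast
  let ?q = "map (map_prod f f) p"
  have q: "set ?q \<subseteq> parcs H"
    using p wellformed' arcs by fastforce
  \<comment> \<open>The base point is listed at both ends of a closed walk, so \<open>cycle\<close>
    demands distinctness of the tail only.\<close>
  have "inj_on f (set (tl (pawalk_verts u p)))"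
    using inj_on_subset[OF inj] walk_verts list.set_sel(2)
    by (metis subset_iff tl_Nil)
  with dist have "distinct (tl (pawalk_verts (f u) ?q))"
    by (simp add: pawalk_verts_map distinct_map flip: map_tl)
  moreover have "pre_digraph.awalk (with_proj H) (f u) ?q (f u)"
    using u verts q pcas_map[OF cas]
    by (auto simp: pre_digraph.awalk_def cas_with_proj_eq)
  ultimately have "pre_digraph.cycle (with_proj H) ?q"
    using \<open>p \<noteq> []\<close> by (auto simp: pre_digraph.cycle_def awalk_verts_with_proj_eq)
  then obtain x y where xy: "is_chord H ?q x y"
    using chordal len unfolding chordal_def by fastforce
  \<comment> \<open>The ends of a chord are tails of arcs of \<open>?q\<close>, hence images of
    tails of arcs of \<open>p\<close>; those tails are the ends of the chord sought in
    \<open>G\<close>.\<close>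
  have "fst ` set ?q = (\<lambda>e. f (fst e)) ` set p"
    by (simp add: image_image)
  with xy obtain e e' where e: "e \<in> set p" "e' \<in> set p" "x = f (fst e)" "y = f (fst e')"
    unfolding is_chord_def by blast
  with xy have chord: "is_chord H ?q (f (fst e)) (f (fst e'))"
    by simp
  have "fst e \<in> pverts G" "fst e' \<in> pverts G"
    using e p arc_fst_in_verts by auto
  then have "(fst e, fst e') \<in> parcs G"
    using chord arcs unfolding is_chord_def by blast
  \<comment> \<open>An arc of \<open>p\<close> between these tails, in either direction, would be
    mapped to an arc of \<open>?q\<close> between the ends of the chord.\<close>
  moreover have "(fst e, fst e') \<notin> set p" "(fst e', fst e) \<notin> set p"
    using chord unfolding is_chord_def by force+
  ultimately have "is_chord G p (fst e) (fst e')"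
    using e unfolding is_chord_def by auto
  then show "\<exists>u v. is_chord G p u v" by blast
qed

lemma zero_divisor_graph_arc_iff:
  assumes "u \<in> pverts (zero_divisor_graph R)" "v \<in> pverts (zero_divisor_graph R)"
  shows "(u, v) \<in> parcs (zero_divisor_graph R) \<longleftrightarrow> u \<noteq> v \<and> u \<otimes>\<^bsub>R\<^esub> v = \<zero>\<^bsub>R\<^esub>"
  using assms by (simp add: zero_divisor_graph_def Let_def)

text \<open>Vertices and arcs depend only on equality, zero and products. Since \<open>f\<close> is
  injective and fixes zero, it also reflects zero, so products vanish in \<open>R\<close> exactly
  when their images do in \<open>S\<close>.\<close>

lemma chordal_zero_divisor_graph_embed:
  assumes R: "cring R"
    and inj: "inj_on f (carrier R)"
    and closed: "f ` carrier R \<subseteq> carrier S"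
    and zero: "f \<zero>\<^bsub>R\<^esub> = \<zero>\<^bsub>S\<^esub>"
    and mult: "\<And>a b. \<lbrakk>a \<in> carrier R; b \<in> carrier R\<rbrakk> \<Longrightarrow> f (a \<otimes>\<^bsub>R\<^esub> b) = f a \<otimes>\<^bsub>S\<^esub> f b"
    and chordal: "chordal (zero_divisor_graph S)"
  shows "chordal (zero_divisor_graph R)"
proof -
  interpret cring R by (fact R)
  interpret G: pair_bidirected_digraph "zero_divisor_graph R"
    by (fact zero_divisor_graph_simple_undirected)
  have f_eq_zero: "f a = \<zero>\<^bsub>S\<^esub> \<longleftrightarrow> a = \<zero>\<^bsub>R\<^esub>" if "a \<in> carrier R" for a
    using that inj zero by (metis inj_on_eq_iff zero_closed)
  have mult_eq_zero: "f a \<otimes>\<^bsub>S\<^esub> f b = \<zero>\<^bsub>S\<^esub> \<longleftrightarrow> a \<otimes>\<^bsub>R\<^esub> b = \<zero>\<^bsub>R\<^esub>"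
    if "a \<in> carrier R" "b \<in> carrier R" for a b
    using that f_eq_zero mult by (metis m_closed)
  have carr: "pverts (zero_divisor_graph R) \<subseteq> carrier R"
    by (auto simp: zero_divisor_graph_def Let_def zero_divisor_def)
  have vert: "f a \<in> pverts (zero_divisor_graph S)" if "a \<in> pverts (zero_divisor_graph R)" for a
  proof -
    from that obtain b where ab: "a \<in> carrier R" "a \<noteq> \<zero>\<^bsub>R\<^esub>" "b \<in> carrier R" "b \<noteq> \<zero>\<^bsub>R\<^esub>"
      "a \<otimes>\<^bsub>R\<^esub> b = \<zero>\<^bsub>R\<^esub>"
      by (auto simp: zero_divisor_graph_def Let_def zero_divisor_def)
    \<comment> \<open>The image of the annihilator \<open>b\<close> of \<open>a\<close> witnesses
      that \<open>f a\<close> is a zero-divisor.\<close>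
    then have "f a \<noteq> \<zero>\<^bsub>S\<^esub>" "f b \<noteq> \<zero>\<^bsub>S\<^esub>" "f a \<otimes>\<^bsub>S\<^esub> f b = \<zero>\<^bsub>S\<^esub>"
      "f a \<in> carrier S" "f b \<in> carrier S"
      using f_eq_zero mult_eq_zero closed by auto
    then show ?thesis
      by (auto simp: zero_divisor_graph_def Let_def zero_divisor_def)
  qed
  show ?thesis
  proof (rule chordal_induced_subgraph[OF G.pair_wf_digraph_axioms _ _ _ chordal])
    show "inj_on f (pverts (zero_divisor_graph R))"
      using inj carr by (rule inj_on_subset)
    show "f ` pverts (zero_divisor_graph R) \<subseteq> pverts (zero_divisor_graph S)"
      using vert by blast
    fix u v assume uv: "u \<in> pverts (zero_divisor_graph R)" "v \<in> pverts (zero_divisor_graph R)"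
    then have "u \<in> carrier R" "v \<in> carrier R"
      using carr by auto
    then show "(f u, f v) \<in> parcs (zero_divisor_graph S) \<longleftrightarrow> (u, v) \<in> parcs (zero_divisor_graph R)"
      using uv vert inj mult_eq_zero by (simp add: zero_divisor_graph_arc_iff inj_on_eq_iff)
  qed
qed

text \<open>Pairing head and tail into a list is a ring homomorphism from the binary product, which
  computes products of elements of the carrier.\<close>

lemma RDirProd_list_mult_Cons:
  assumes "a \<in> carrier R" "b \<in> carrier R"
    and "as \<in> carrier (RDirProd_list Rs)" "bs \<in> carrier (RDirProd_list Rs)"
  shows "(a # as) \<otimes>\<^bsub>RDirProd_list (R # Rs)\<^esub> (b # bs) =
    (a \<otimes>\<^bsub>R\<^esub> b) # (as \<otimes>\<^bsub>RDirProd_list Rs\<^esub> bs)"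
  using ring_hom_mult[OF RDirProd_list_hom1[of R Rs], of "(a, as)" "(b, bs)"] assms
  by (simp add: RDirProd_def DirProd_def monoid.defs)

lemma RDirProd_list_update_mem:
  assumes "as \<in> carrier (RDirProd_list Rs)" "i < length Rs" "a \<in> carrier (Rs ! i)"
  shows "as[i := a] \<in> carrier (RDirProd_list Rs)"
  using assms RDirProd_list_carrier_mem[OF assms(1)]
  by (intro RDirProd_list_carrier_memI) (auto simp: nth_list_update)

text \<open>By induction on \<open>Rs\<close>: if the update hits the head, the tails multiply as
  zero times zero; otherwise the heads do, and the induction hypothesis covers the tails.\<close>

lemma RDirProd_list_update_zero_mult:
  assumes "\<And>i. i < length Rs \<Longrightarrow> ring (Rs ! i)" and "i < length Rs"
    and "a \<in> carrier (Rs ! i)" "b \<in> carrier (Rs ! i)"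
  shows "\<zero>\<^bsub>RDirProd_list Rs\<^esub>[i := a \<otimes>\<^bsub>Rs ! i\<^esub> b] =
    \<zero>\<^bsub>RDirProd_list Rs\<^esub>[i := a] \<otimes>\<^bsub>RDirProd_list Rs\<^esub> \<zero>\<^bsub>RDirProd_list Rs\<^esub>[i := b]"
  using assms
proof (induction Rs arbitrary: i)
  case Nil
  then show ?case by simp
next
  case (Cons R Rs)
  have rings: "ring (Rs ! j)" if "j < length Rs" for j
    using Cons.prems(1)[of "Suc j"] that by simp
  interpret R: ring R using Cons.prems(1)[of 0] by simp
  interpret P: ring "RDirProd_list Rs" by (rule RDirProd_list_is_ring) (fact rings)
  show ?case
  proof (cases i)
    case 0
    then show ?thesis
      using Cons.prems by (simp add: RDirProd_list_zero' RDirProd_list_mult_Cons)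
  next
    case (Suc j)
    show ?thesis
      using Cons.IH[OF rings, of j] Cons.prems Suc
      by (simp add: RDirProd_list_zero' RDirProd_list_mult_Cons RDirProd_list_update_mem)
  qed
qed

lemma RDirProd_list_zero_nth:
  "i < length Rs \<Longrightarrow> \<zero>\<^bsub>RDirProd_list Rs\<^esub> ! i = \<zero>\<^bsub>Rs ! i\<^esub>"
  by (induction Rs arbitrary: i) (auto simp: RDirProd_list_zero' nth_Cons split: nat.split)

theorem theorem3p12:
  fixes Rs :: "('a, 'm) ring_scheme list"
  assumes "\<And>i. i < length Rs \<Longrightarrow> cring (Rs ! i)"
    and "\<exists>i < length Rs. \<not> chordal (zero_divisor_graph (Rs ! i))"
  shows "\<not> chordal (zero_divisor_graph (RDirProd_list Rs))"
proof
  let ?P = "RDirProd_list Rs"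
  assume chordal: "chordal (zero_divisor_graph ?P)"
  from assms(2) obtain i where i: "i < length Rs" "\<not> chordal (zero_divisor_graph (Rs ! i))"
    by blast
  have rings: "ring (Rs ! j)" if "j < length Rs" for j
    using assms(1)[OF that] by (rule cring.axioms)
  interpret P: ring ?P by (rule RDirProd_list_is_ring) (fact rings)
  have "chordal (zero_divisor_graph (Rs ! i))"
  proof (rule chordal_zero_divisor_graph_embed[where f = "\<lambda>a. \<zero>\<^bsub>?P\<^esub>[i := a]" and S = ?P])
    show "cring (Rs ! i)" using assms(1) i(1) .
    \<comment> \<open>Reading off entry \<open>i\<close> recovers \<open>a\<close>, provided
      \<open>i\<close> is in range: an update out of range changes nothing. Hence the appeal to the
      length of the zero list.\<close>
    show "inj_on (\<lambda>a. \<zero>\<^bsub>?P\<^esub>[i := a]) (carrier (Rs ! i))"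
      using i(1) RDirProd_list_carrier_mem(1)[OF P.zero_closed] by (metis inj_onI nth_list_update_eq)
    show "(\<lambda>a. \<zero>\<^bsub>?P\<^esub>[i := a]) ` carrier (Rs ! i) \<subseteq> carrier ?P"
      using i(1) RDirProd_list_update_mem[OF P.zero_closed] by blast
    show "\<zero>\<^bsub>?P\<^esub>[i := \<zero>\<^bsub>Rs ! i\<^esub>] = \<zero>\<^bsub>?P\<^esub>"
      using i(1) by (metis RDirProd_list_zero_nth list_update_id)
  qed (use RDirProd_list_update_zero_mult[OF rings i(1)] chordal in auto)
  with i(2) show False by contradiction
qed

end
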